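(* Let $\mathcal{A}$ and $\mathcal{B}$ be two complex unital Banach algebras and let $\mathcal{T}\colon\mathcal{A}\to\mathcal{B}$ be a surjective (not necessarily continuous) algebra homomorphism that has the lifting property. Let $a\in\mathcal{A}$ and $b\in\mathcal{B}$ be such that $\mathcal{T}(a)=b$. Then $b$ is Koliha-Drazin invertible but not invertible (respectively Drazin invertible but not invertible; respectively Koliha-Drazin invertible but not Drazin invertible) if and only if there exist - an idempotent $p=p^2\in\mathcal{A}$ with $p\notin N(\mathcal{T})$, - $x\in\mathcal{A}$ with $pxp\in\mathscr{R}_{\mathcal{T}}(\mathcal{A})$ (respectively $pxp\in\mathscr{N}_{\mathcal{T}}(\mathcal{A})$; respectively $pxp\in\mathscr{R}_{\mathcal{T}}(\mathcal{A})\setminus\mathscr{N}_{\mathcal{T}}(\mathcal{A})$), - $y\in(1-p)\mathcal{A}(1-p)$ with $y\in\Phi_{\mathcal{T}_{p',q'}}(p'\mathcal{A}p')$, where $q=\mathcal{T}(p)$, $p'=1-p$, $q'=1-q$, and - $z\in N(\mathcal{T})$ such that $a=pxp+y+z$.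
   Context: $N(\mathcal{T})$ is the kernel of $\mathcal{T}$. A surjective algebra homomorphism $\mathcal{T}\colon\mathcal{A}\to\mathcal{B}$ has the lifting property if for every idempotent $q\in\mathcal{B}$ there is an idempotent $p\in\mathcal{A}$ with $\mathcal{T}(p)=q$. For an idempotent $e\ne 0$ of a unital Banach algebra $\mathcal{D}$, $e\mathcal{D}e$ is a unital Banach algebra with unit $e$ (if $e=0$ it is the zero algebra, in which $0$ is regarded as invertible). For $p\in\mathcal{A}$ idempotent and $q=\mathcal{T}(p)$, put $p'=1-p$, $q'=1-q$, and let $\mathcal{T}_{p',q'}\colon p'\mathcal{A}p'\to q'\mathcal{B}q'$ be the restriction of $\mathcal{T}$. $\Phi_{\mathcal{T}_{p',q'}}(p'\mathcal{A}p')=\{x\in p'\mathcal{A}p'\colon \mathcal{T}(x)\text{ is invertible in } q'\mathcal{B}q'\}$ (Fredholm elements relative to $\mathcal{T}_{p',q'}$). $\mathscr{R}_{\mathcal{T}}(\mathcal{A})=\{x\in\mathcal{A}\colon\mathcal{T}(x)\text{ is quasi-nilpotent in }\mathcal{B}\}$ (Riesz elements relative to $\mathcal{T}$). $\mathscr{N}_{\mathcal{T}}(\mathcal{A})=\{x\in\mathcal{A}\colon \exists k\in\mathbb{N},\ k\ge1,\ x^k\in N(\mathcal{T})\}$ ($\mathcal{T}$-nilpotent elements). An element $b$ of a unital Banach algebra $\mathcal{B}$ is Drazin invertible if there exist $c\in\mathcal{B}$ and $m\in\mathbb{N}$ with $bc=cb$, $cbc=c$, $b^mcb=b^m$. It is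 Koliha-Drazin (generalized Drazin) invertible if there exists $c\in\mathcal{B}$ with $bc=cb$, $cbc=c$ and $bcb=b+w$ for some quasi-nilpotent $w\in\mathcal{B}$. *)

theory Defs
  imports Complex_Main
begin

text \<open>
  Complex unital Banach algebras. The unit is nonzero (part of class \<open>ring_1\<close>), but in contrast to
  class \<open>real_normed_algebra_1\<close> its norm need not be 1, so that corners \<open>e D e\<close> with \<open>e \<noteq> 0\<close>
  are algebras of the same kind.
\<close>

class scaleC = scaleR +
  fixes scaleC :: "complex \<Rightarrow> 'a \<Rightarrow> 'a" (infixr "*\<^sub>C" 75)

class complex_unital_banach_algebra = real_normed_algebra + ring_1 + banach + scaleC +
  assumes scaleC_add_right: "c *\<^sub>C (x + y) = c *\<^sub>C x + c *\<^sub>C y"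
    and scaleC_add_left: "(c + d) *\<^sub>C x = c *\<^sub>C x + d *\<^sub>C x"
    and scaleC_scaleC: "c *\<^sub>C (d *\<^sub>C x) = (c * d) *\<^sub>C x"
    and scaleC_one: "1 *\<^sub>C x = x"
    and scaleR_eq_scaleC: "r *\<^sub>R x = complex_of_real r *\<^sub>C x"
    and mult_scaleC_left: "(c *\<^sub>C x) * y = c *\<^sub>C (x * y)"
    and mult_scaleC_right: "x * (c *\<^sub>C y) = c *\<^sub>C (x * y)"
    and norm_scaleC: "norm (c *\<^sub>C x) = cmod c * norm x"

subsection \<open>Elements of a Banach algebra\<close>

definition alg_invertible :: "'a::ring_1 \<Rightarrow> bool" where
  "alg_invertible x \<longleftrightarrow> (\<exists>y. x * y = 1 \<and> y * x = 1)"

definition alg_spectrum :: "'a::complex_unital_banach_algebra \<Rightarrow> complex set" where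
  "alg_spectrum x = {c. \<not> alg_invertible (x - c *\<^sub>C 1)}"

definition quasi_nilpotent :: "'a::complex_unital_banach_algebra \<Rightarrow> bool" where
  "quasi_nilpotent x \<longleftrightarrow> alg_spectrum x = {0}"

definition idempotent_elem :: "'a::ring_1 \<Rightarrow> bool" where
  "idempotent_elem e \<longleftrightarrow> e * e = e"

definition Drazin_invertible :: "'a::ring_1 \<Rightarrow> bool" where
  "Drazin_invertible b \<longleftrightarrow>
     (\<exists>c. \<exists>m::nat. b * c = c * b \<and> c * b * c = c \<and> b ^ m * c * b = b ^ m)"

definition Koliha_Drazin_invertible :: "'a::complex_unital_banach_algebra \<Rightarrow> bool" where
  "Koliha_Drazin_invertible b \<longleftrightarrow>
     (\<exists>c w. b * c = c * b \<and> c * b * c = c \<and> b * c * b = b + w \<and> quasi_nilpotent w)"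

subsection \<open>Corners\<close>

definition corner :: "'a::ring_1 \<Rightarrow> 'a set" where
  "corner e = {e * x * e | x. True}"

text \<open>For \<open>e = 0\<close> the corner is \<open>{0}\<close>, and 0 is invertible in it.\<close>

definition corner_invertible :: "'a::ring_1 \<Rightarrow> 'a \<Rightarrow> bool" where
  "corner_invertible e x \<longleftrightarrow> x \<in> corner e \<and> (\<exists>y \<in> corner e. x * y = e \<and> y * x = e)"

subsection \<open>Homomorphisms\<close>

text \<open>Neither continuity nor \<open>T 1 = 1\<close> is required; the latter holds when \<open>T\<close> is surjective.\<close>

definition algebra_hom ::
    "('a::complex_unital_banach_algebra \<Rightarrow> 'b::complex_unital_banach_algebra) \<Rightarrow> bool" where
  "algebra_hom T \<longleftrightarrow> Vector_Spaces.linear scaleC scaleC T \<and> (\<forall>x y. T (x * y) = T x * T y)"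

definition hom_kernel :: "('a \<Rightarrow> 'b::zero) \<Rightarrow> 'a set" where
  "hom_kernel T = {x. T x = 0}"

definition lifting_property :: "('a::ring_1 \<Rightarrow> 'b::ring_1) \<Rightarrow> bool" where
  "lifting_property T \<longleftrightarrow>
     (\<forall>q. idempotent_elem q \<longrightarrow> (\<exists>p. idempotent_elem p \<and> T p = q))"

definition Riesz_elems :: "('a \<Rightarrow> 'b::complex_unital_banach_algebra) \<Rightarrow> 'a set" where
  "Riesz_elems T = {x. quasi_nilpotent (T x)}"

definition hom_nilpotent_elems :: "('a::ring_1 \<Rightarrow> 'b::zero) \<Rightarrow> 'a set" where
  "hom_nilpotent_elems T = {x. \<exists>k::nat. k \<ge> 1 \<and> x ^ k \<in> hom_kernel T}"

text \<open>Fredholm elements relative to the restriction of \<open>T\<close> to a map from \<open>corner e\<close> to \<open>corner f\<close>.\<close>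

definition corner_Fredholm_elems :: "('a::ring_1 \<Rightarrow> 'b::ring_1) \<Rightarrow> 'a \<Rightarrow> 'b \<Rightarrow> 'a set" where
  "corner_Fredholm_elems T e f = {x \<in> corner e. corner_invertible f (T x)}"

end

theory Submission
  imports Defs "HOL-Analysis.Analysis"
begin

text \<open>
  An idempotent \<open>q\<close> that splits \<open>b\<close> into a block \<open>n\<close> in the corner of \<open>q\<close> and an invertible block
  in the corner of \<open>1 - q\<close> is the same thing as a commuting generalized inverse \<open>c\<close> with
  \<open>c b c = c\<close>: from \<open>c\<close> one takes \<open>q = 1 - b c\<close> and \<open>n = b - b c b\<close>, and conversely \<open>c\<close> is the
  inverse of the second block. Under this correspondence (\<open>splits_alongI\<close>, \<open>splits_alongE\<close>)
  Koliha-Drazin invertibility of \<open>b\<close> says that \<open>n\<close> is quasi-nilpotent, and Drazin invertibility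
  that \<open>n\<close> is nilpotent. Since \<open>T\<close> lifts idempotents, every splitting of \<open>T a\<close> comes from an
  idempotent \<open>p\<close> of the domain: the diagonal blocks of \<open>a\<close> along \<open>p\<close> map to the blocks of \<open>T a\<close>, and
  the remainder of \<open>a\<close> lies in the kernel (\<open>splitting_lifts_iff\<close>).

  Two points need analysis: if \<open>n\<close> is quasi-nilpotent and \<open>q \<noteq> 0\<close>, then \<open>b\<close> is not invertible
  (\<open>splits_along_not_invertible\<close>); and if \<open>n\<close> is quasi-nilpotent and \<open>b\<close> is Drazin invertible,
  then \<open>n\<close> is nilpotent
  (\<open>Drazin_imp_nilpotent_part\<close>). Both express a fixed element \<open>x\<close> as \<open>n ^ j * y * d ^ j\<close> for every
  \<open>j\<close>, and then \<open>x = 0\<close> because \<open>norm (n ^ (2 ^ k))\<close> is eventually smaller than \<open>r ^ (2 ^ k)\<close> for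
  every \<open>r > 0\<close> (\<open>quasi_nilpotent_geometric_zero\<close>). This consequence of the spectral radius
  formula is proved from the definition of the spectrum, by averaging resolvents over roots of
  unity (\<open>quasi_nilpotent_scaled_powers_tendsto_0\<close>).
\<close>

section \<open>Scalars and powers\<close>

lemma scaleC_zero_left: "0 *\<^sub>C (x :: 'a::complex_unital_banach_algebra) = 0"
  using scaleR_eq_scaleC[of 0 x] by simp

lemma scaleC_minus_left:
  "(- c) *\<^sub>C (x :: 'a::complex_unital_banach_algebra) = - (c *\<^sub>C x)"
proof -
  have "(- c) *\<^sub>C x + c *\<^sub>C x = 0"
    using scaleC_add_left[of "- c" c x] by (simp add: scaleC_zero_left)
  then show ?thesis by (simp add: eq_neg_iff_add_eq_0)
qed

lemma scaleC_diff_left: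
  "(c - d) *\<^sub>C (x :: 'a::complex_unital_banach_algebra) = c *\<^sub>C x - d *\<^sub>C x"
  using scaleC_add_left[of c "- d" x] by (simp add: scaleC_minus_left)

lemma scaleC_diff_right:
  "c *\<^sub>C ((x :: 'a::complex_unital_banach_algebra) - y) = c *\<^sub>C x - c *\<^sub>C y"
  using scaleC_add_right[of c "x - y" y] by (simp add: algebra_simps)

lemma scaleC_power:
  "(c *\<^sub>C (x :: 'a::complex_unital_banach_algebra)) ^ n = (c ^ n) *\<^sub>C (x ^ n)"
  by (induction n)
    (simp_all add: scaleC_one mult_scaleC_left mult_scaleC_right scaleC_scaleC mult.commute[of c])

lemma commute_power:
  fixes b c :: "'a::monoid_mult"
  assumes "b * c = c * b"
  shows "b ^ k * c = c * b ^ k"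
proof (induction k)
  case (Suc k)
  have "b ^ Suc k * c = b * (b ^ k * c)" by (simp add: mult.assoc)
  also have "\<dots> = (b * c) * b ^ k" by (simp add: Suc mult.assoc)
  also have "\<dots> = c * b ^ Suc k" by (simp add: assms mult.assoc)
  finally show ?case .
qed simp

lemma norm_power_le:
  fixes x :: "'a::{real_normed_algebra, ring_1}"
  shows "norm (x ^ n) \<le> norm (1 :: 'a) * norm x ^ n"
proof (induction n)
  case (Suc n)
  have "norm (x ^ Suc n) \<le> norm x * norm (x ^ n)"
    by (simp add: norm_mult_ineq)
  also have "\<dots> \<le> norm x * (norm (1 :: 'a) * norm x ^ n)"
    by (intro mult_left_mono Suc norm_ge_zero)
  finally show ?case by (simp add: mult_ac)
qed simp

section \<open>Powers of a quasi-nilpotent element\<close>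

lemma power_two_power_tendsto_0:
  fixes s :: "'a::{real_normed_algebra, ring_1}"
  assumes "norm (s ^ (2 ^ k)) \<le> 1 / 2"
  shows "(\<lambda>j. s ^ (2 ^ j)) \<longlonglongrightarrow> 0"
proof -
  define K where "K = norm (1 :: 'a)"
  have bound: "norm (s ^ (2 ^ (j + k))) \<le> K * (1 / 2) ^ (2 ^ j)" for j
  proof -
    have "norm (s ^ (2 ^ (j + k))) = norm ((s ^ (2 ^ k)) ^ (2 ^ j))"
      by (simp add: power_add power_mult [symmetric] mult.commute)
    also have "\<dots> \<le> K * norm (s ^ (2 ^ k)) ^ (2 ^ j)"
      unfolding K_def by (rule norm_power_le)
    also have "\<dots> \<le> K * (1 / 2) ^ (2 ^ j)"
      by (intro mult_left_mono power_mono assms) (auto simp: K_def)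
    finally show ?thesis .
  qed
  have "(\<lambda>j. K * (1 / 2) ^ (2 ^ j)) \<longlonglongrightarrow> K * 0"
  proof (intro tendsto_mult tendsto_const)
    have sm: "strict_mono (\<lambda>j :: nat. (2 :: nat) ^ j)"
      by (intro strict_monoI) simp
    have "(\<lambda>n. (1 / 2 :: real) ^ n) \<longlonglongrightarrow> 0"
      by (rule LIMSEQ_power_zero) simp
    from LIMSEQ_subseq_LIMSEQ[OF this sm]
    show "(\<lambda>j. (1 / 2 :: real) ^ (2 ^ j)) \<longlonglongrightarrow> 0" by (simp add: o_def)
  qed
  then have "(\<lambda>j. K * (1 / 2) ^ (2 ^ j)) \<longlonglongrightarrow> 0" by simp
  then have "(\<lambda>j. s ^ (2 ^ (j + k))) \<longlonglongrightarrow> 0"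
    by (rule Lim_null_comparison[rotated]) (use bound in auto)
  then show ?thesis by (rule LIMSEQ_offset)
qed

text \<open>
  The resolvent identity, with only the one-sided inverse that each of the two points needs.
\<close>

lemma resolvent_diff:
  fixes w u v :: "'a::complex_unital_banach_algebra"
  assumes u: "u * (c *\<^sub>C 1 - w) = 1" and v: "(d *\<^sub>C 1 - w) * v = 1"
  shows "u - v = (d - c) *\<^sub>C (u * v)"
proof -
  have "u - v = u * ((d *\<^sub>C 1 - w) * v) - (u * (c *\<^sub>C 1 - w)) * v"
    by (simp only: u v mult_1_left mult_1_right)
  also have "\<dots> = (d - c) *\<^sub>C (u * v)"
    by (simp add: algebra_simps scaleC_diff_left mult_scaleC_left mult_scaleC_right)
  finally show ?thesis .
qed

text \<open>
  Away from \<open>0\<close> the resolvent of an element without nonzero spectrum is bounded: near infinity by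
  the resolvent equation, and on an annulus by compactness.
\<close>

lemma resolvent_bounded:
  fixes w :: "'a::complex_unital_banach_algebra" and V :: "complex \<Rightarrow> 'a"
  assumes R: "\<And>c. c \<noteq> 0 \<Longrightarrow> (c *\<^sub>C 1 - w) * V c = 1"
    and L: "\<And>c. c \<noteq> 0 \<Longrightarrow> V c * (c *\<^sub>C 1 - w) = 1"
    and r: "r > 0"
  obtains M where "M > 0" "\<And>c. cmod c \<ge> r \<Longrightarrow> norm (V c) \<le> M"
proof -
  have diff: "V c - V d = (d - c) *\<^sub>C (V c * V d)" if "c \<noteq> 0" "d \<noteq> 0" for c d
    using resolvent_diff L[OF that(1)] R[OF that(2)] by blast
  have local: "norm (V c) \<le> 2 * norm (V d)"
    if "c \<noteq> 0" "d \<noteq> 0" "dist d c * norm (V d) \<le> 1 / 2" for c d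
  proof -
    have "norm (V c) \<le> norm (V d) + norm (V c - V d)"
      by (metis add.commute diff_add_cancel norm_triangle_ineq)
    also have "norm (V c - V d) \<le> dist d c * (norm (V c) * norm (V d))"
      unfolding diff[OF that(1,2)] norm_scaleC dist_norm
      by (intro mult_left_mono norm_mult_ineq norm_ge_zero)
    also have "\<dots> = norm (V c) * (dist d c * norm (V d))" by simp
    also have "\<dots> \<le> norm (V c) * (1 / 2)"
      by (intro mult_left_mono that norm_ge_zero)
    finally show ?thesis by simp
  qed
  define B where "B = norm w + 1"
  define S where "S = cball 0 B - ball (0 :: complex) r"
  have "compact S" unfolding S_def by (intro compact_diff compact_cball open_ball)
  define e where "e d = 1 / (2 * norm (V d) + 1)" for d
  have e: "e d > 0" for d by (auto simp: e_def intro!: divide_pos_pos add_nonneg_pos)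
  have nz: "c \<noteq> 0" if "c \<in> S" for c using that r by (auto simp: S_def)
  obtain D where D: "D \<subseteq> S" "finite D" "S \<subseteq> (\<Union>d\<in>D. ball d (e d))"
  proof (rule compactE_image[OF \<open>compact S\<close>, of S "\<lambda>d. ball d (e d)"])
    show "S \<subseteq> (\<Union>d\<in>S. ball d (e d))" using e by auto
  qed auto
  define M where "M = norm (1 :: 'a) + (\<Sum>d\<in>D. 2 * norm (V d))"
  have M1: "norm (1 :: 'a) \<le> M" unfolding M_def by (simp add: sum_nonneg)
  have "M > 0" using M1 by (rule less_le_trans[rotated]) simp
  moreover have "norm (V c) \<le> M" if "cmod c \<ge> r" for c
  proof (cases "cmod c \<le> B")
    case True
    then have "c \<in> S" using that by (auto simp: S_def)
    then obtain d where d: "d \<in> D" "dist d c < e d" using D by auto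
    have "dist d c * norm (V d) \<le> e d * norm (V d)"
      by (intro mult_right_mono) (use d in auto)
    also have "\<dots> \<le> 1 / 2" by (simp add: e_def divide_simps add_nonneg_pos)
    finally have "norm (V c) \<le> 2 * norm (V d)"
      using local[of c d] nz \<open>c \<in> S\<close> d(1) D(1) by blast
    also have "\<dots> \<le> (\<Sum>d\<in>D. 2 * norm (V d))"
      by (rule member_le_sum) (use d D in auto)
    also have "\<dots> \<le> M" by (simp add: M_def)
    finally show ?thesis .
  next
    case False
    have c0: "c \<noteq> 0" using that r by auto
    have "c *\<^sub>C V c = 1 + w * V c"
      using R[OF c0] by (simp add: algebra_simps mult_scaleC_left)
    then have "cmod c * norm (V c) = norm (1 + w * V c)" by (metis norm_scaleC)
    also have "\<dots> \<le> norm (1 :: 'a) + norm w * norm (V c)"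
      by (rule norm_triangle_le) (simp add: norm_mult_ineq)
    finally have "(cmod c - norm w) * norm (V c) \<le> norm (1 :: 'a)"
      by (simp add: algebra_simps)
    moreover have "1 * norm (V c) \<le> (cmod c - norm w) * norm (V c)"
      by (intro mult_right_mono) (use False in \<open>auto simp: B_def\<close>)
    ultimately show ?thesis using M1 by linarith
  qed
  ultimately show ?thesis using that by blast
qed

text \<open>
  The analytic core: the hard half of the spectral radius formula, along the exponents \<open>2 ^ k\<close>, for
  an element whose spectrum has no nonzero point. In the proof, \<open>f k c\<close> is the average of the
  function \<open>c \<mapsto> c (c - w)\<^sup>-\<^sup>1\<close> over the rotations of \<open>c\<close> by the \<open>2 ^ k\<close>-th roots of unity. On
  \<open>cmod c \<ge> r\<close> these averages share one Lipschitz constant, and \<open>f k c\<close> inverts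
  \<open>1 - (w / c) ^ (2 ^ k)\<close>. Hence convergence of \<open>(w / c) ^ (2 ^ k)\<close> to \<open>0\<close> passes from one real
  \<open>c \<ge> r\<close> to all others within a fixed distance, and so descends from large \<open>c\<close>, where it is
  clear, to \<open>r\<close>. This elementary argument, due to Rickart, replaces contour integration of
  functions with values in the algebra.
\<close>

lemma quasi_nilpotent_scaled_powers_tendsto_0:
  fixes w :: "'a::complex_unital_banach_algebra"
  assumes inv: "\<And>c. c \<noteq> 0 \<Longrightarrow> alg_invertible (w - c *\<^sub>C 1)" and r: "r > 0"
  shows "(\<lambda>k. (complex_of_real (1 / r) *\<^sub>C w) ^ (2 ^ k)) \<longlonglongrightarrow> 0"
proof -
  have "\<exists>v. (c *\<^sub>C 1 - w) * v = 1 \<and> v * (c *\<^sub>C 1 - w) = 1" if c: "c \<noteq> 0" for c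
  proof -
    obtain v where "(w - c *\<^sub>C 1) * v = 1" "v * (w - c *\<^sub>C 1) = 1"
      using inv[OF c] by (auto simp: alg_invertible_def)
    then show ?thesis
      by (intro exI[of _ "- v"]) (simp add: algebra_simps)
  qed
  then obtain V where
    R: "\<And>c. c \<noteq> 0 \<Longrightarrow> (c *\<^sub>C 1 - w) * V c = 1" and
    L: "\<And>c. c \<noteq> 0 \<Longrightarrow> V c * (c *\<^sub>C 1 - w) = 1"
    by metis
  obtain M where M: "M > 0" "\<And>c. cmod c \<ge> r \<Longrightarrow> norm (V c) \<le> M"
    using resolvent_bounded[of w V r] R L r by blast
  define S where "S c = inverse c *\<^sub>C w" for c
  \<comment> \<open>Averaging over \<open>c\<close> and \<open>om k * c\<close> uses that \<open>om k ^ (2 ^ k) = -1\<close>, and that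
      \<open>((1 - u)\<^sup>-\<^sup>1 + (1 + u)\<^sup>-\<^sup>1) / 2 = (1 - u\<^sup>2)\<^sup>-\<^sup>1\<close>.\<close>
  define om where "om k = cis (pi / 2 ^ k)" for k :: nat
  have om: "om k ^ (2 ^ k) = -1" "cmod (om k) = 1" for k
  proof -
    have "real (2 ^ k) * (pi / 2 ^ k) = pi" by simp
    then show "om k ^ (2 ^ k) = -1" unfolding om_def Complex.DeMoivre by (simp only: cis_pi)
  qed (simp add: om_def)
  define f where "f = rec_nat (\<lambda>c. c *\<^sub>C V c) (\<lambda>k g c. (1 / 2 :: real) *\<^sub>R (g c + g (om k * c)))"
  have f0: "f 0 c = c *\<^sub>C V c" for c by (simp add: f_def)
  have fS: "f (Suc k) c = (1 / 2 :: real) *\<^sub>R (f k c + f k (om k * c))" for k c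
    by (simp add: f_def)
  have finv: "(1 - S c ^ (2 ^ k)) * f k c = 1" if "c \<noteq> 0" for c k
    using that
  proof (induction k arbitrary: c)
    case 0
    have "(1 - S c) * (c *\<^sub>C V c) = (c *\<^sub>C 1 - w) * V c"
      using 0 by (simp add: S_def left_diff_distrib mult_scaleC_left scaleC_diff_right
          mult_scaleC_right scaleC_scaleC scaleC_one)
    then show ?case using R 0 by (simp add: f0)
  next
    case (Suc k)
    define u where "u = S c ^ (2 ^ k)"
    have "om k * c \<noteq> 0" using Suc.prems om(2)[of k] by auto
    have "S (om k * c) ^ (2 ^ k) = inverse (om k) ^ (2 ^ k) *\<^sub>C u"
      unfolding S_def u_def scaleC_power by (simp add: scaleC_scaleC power_mult_distrib)
    also have "\<dots> = - u"
      by (simp add: power_inverse om scaleC_minus_left scaleC_one)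
    finally have G: "(1 + u) * f k (om k * c) = 1"
      using Suc.IH[OF \<open>om k * c \<noteq> 0\<close>] by simp
    have F: "(1 - u) * f k c = 1" using Suc by (simp add: u_def)
    have uu: "S c ^ (2 ^ Suc k) = u * u"
      by (simp add: u_def mult_2 power_add)
    have "(1 - u * u) * (f k c + f k (om k * c)) =
        (1 + u) * ((1 - u) * f k c) + (1 - u) * ((1 + u) * f k (om k * c))"
      by (simp add: algebra_simps)
    also have "\<dots> = 1 + 1" unfolding F G by simp
    also have "\<dots> = (2 :: real) *\<^sub>R 1" by (simp add: scaleR_2)
    finally show ?case unfolding fS uu by simp
  qed
  define Lc where "Lc = norm w * (M * M) + 1"
  have "Lc > 0" unfolding Lc_def using M by (intro add_nonneg_pos) auto
  have lip: "norm (f k c - f k d) \<le> Lc * dist c d" if "cmod c \<ge> r" "cmod d \<ge> r" for c d k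
    using that
  proof (induction k arbitrary: c d)
    case 0
    have nz: "c \<noteq> 0" "d \<noteq> 0" using 0 r by auto
    have res: "e *\<^sub>C V e = 1 + w * V e" if "e \<noteq> 0" for e
      using R[OF that] by (simp add: algebra_simps mult_scaleC_left)
    have "f 0 c - f 0 d = w * (V c - V d)"
      unfolding f0 res[OF nz(1)] res[OF nz(2)] by (simp add: right_diff_distrib)
    also have "V c - V d = (d - c) *\<^sub>C (V c * V d)"
      using resolvent_diff L[OF nz(1)] R[OF nz(2)] by blast
    finally have "f 0 c - f 0 d = w * ((d - c) *\<^sub>C (V c * V d))" .
    then have "norm (f 0 c - f 0 d) \<le> norm w * (dist c d * norm (V c * V d))"
      using norm_mult_ineq[of w "(d - c) *\<^sub>C (V c * V d)"]
      by (simp add: norm_scaleC dist_norm norm_minus_commute)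
    also have "norm (V c * V d) \<le> norm (V c) * norm (V d)" by (rule norm_mult_ineq)
    also have "\<dots> \<le> M * M" using M 0 by (intro mult_mono) auto
    finally have "norm (f 0 c - f 0 d) \<le> norm w * (dist c d * (M * M))"
      by (simp add: mult_left_mono)
    then show ?case by (simp add: Lc_def algebra_simps add_increasing)
  next
    case (Suc k)
    have "f (Suc k) c - f (Suc k) d =
        (1 / 2 :: real) *\<^sub>R ((f k c - f k d) + (f k (om k * c) - f k (om k * d)))"
      unfolding fS by (simp add: algebra_simps)
    then have "norm (f (Suc k) c - f (Suc k) d) \<le>
        1 / 2 * (norm (f k c - f k d) + norm (f k (om k * c) - f k (om k * d)))"
      using norm_triangle_ineq[of "f k c - f k d" "f k (om k * c) - f k (om k * d)"] by simp
    also have "norm (f k (om k * c) - f k (om k * d)) \<le> Lc * dist (om k * c) (om k * d)"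
      using Suc by (intro Suc.IH) (auto simp: norm_mult om)
    also have "dist (om k * c) (om k * d) = dist c d"
      unfolding dist_norm right_diff_distrib[symmetric] norm_mult om by simp
    finally show ?case using Suc.IH[OF Suc.prems] by simp
  qed
  have step: "(\<lambda>k. S (complex_of_real d) ^ (2 ^ k)) \<longlonglongrightarrow> 0"
    if conv: "(\<lambda>k. S (complex_of_real c) ^ (2 ^ k)) \<longlonglongrightarrow> 0"
      and cd: "c \<ge> r" "d \<ge> r" "\<bar>c - d\<bar> * Lc \<le> 1 / 6" for c d :: real
  proof -
    let ?c = "complex_of_real c" and ?d = "complex_of_real d"
    have nz: "?c \<noteq> 0" "?d \<noteq> 0" and cm: "cmod ?c \<ge> r" "cmod ?d \<ge> r" using cd r by auto
    \<comment> \<open>The constants make \<open>f k c\<close> lie within \<open>1 / 6\<close> of \<open>1\<close>, hence \<open>f k d\<close> within \<open>1 / 3\<close>, which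
        bounds \<open>(w / d) ^ (2 ^ k)\<close> by \<open>1 / 2\<close> for this one \<open>k\<close>; repeated squaring does the rest.\<close>
    have "eventually (\<lambda>k. norm (S ?c ^ (2 ^ k)) < 1 / (6 * norm (1 :: 'a) + 1)) sequentially"
      by (rule order_tendstoD(2)[OF tendsto_norm_zero[OF conv]])
        (auto intro!: divide_pos_pos add_nonneg_pos)
    then obtain k where k: "norm (S ?c ^ (2 ^ k)) < 1 / (6 * norm (1 :: 'a) + 1)"
      by (auto simp: eventually_sequentially)
    define s where "s = S ?c ^ (2 ^ k)"
    define t where "t = S ?d ^ (2 ^ k)"
    define x where "x = norm (f k ?c - 1)"
    define K where "K = norm (1 :: 'a)"
    have K: "K > 0" by (simp add: K_def)
    have s1: "norm s * (6 * K + 1) < 1"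
      using k K by (simp add: s_def K_def field_simps add_nonneg_pos)
    have "f k ?c - 1 = s * 1 + s * (f k ?c - 1)"
      using finv[OF nz(1), of k] by (simp add: s_def algebra_simps)
    then have "x \<le> norm (s * 1) + norm (s * (f k ?c - 1))"
      unfolding x_def by (metis norm_triangle_ineq)
    also have "\<dots> \<le> norm s * K + norm s * x"
      unfolding K_def x_def by (intro add_mono norm_mult_ineq)
    finally have x1: "x \<le> norm s * K + norm s * x" .
    have "norm s * (6 * K) \<le> 1 - norm s" using s1 by (simp add: algebra_simps)
    then have "(6 * x) * (1 - norm s) \<le> 1 * (1 - norm s)" using x1 by (simp add: algebra_simps)
    moreover have "1 - norm s > 0"
    proof -
      have "norm s * (6 * K) \<ge> 0" using K by simp
      then show ?thesis using s1 by (simp add: algebra_simps)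
    qed
    ultimately have "6 * x \<le> 1" by (rule mult_right_le_imp_le)
    then have x: "x \<le> 1 / 6" by simp
    have "norm (f k ?d - f k ?c) \<le> Lc * dist ?d ?c" by (intro lip cm)
    also have "\<dots> \<le> 1 / 6"
      using cd(3) by (simp add: dist_real_def mult.commute abs_minus_commute)
    finally have y: "norm (f k ?d - 1) \<le> 1 / 3"
      using norm_triangle_ineq[of "f k ?d - f k ?c" "f k ?c - 1"] x by (simp add: x_def)
    have "t = (f k ?d - 1) - t * (f k ?d - 1)"
      using finv[OF nz(2), of k] by (simp add: t_def algebra_simps)
    then have "norm t \<le> norm (f k ?d - 1) + norm (t * (f k ?d - 1))"
      by (metis norm_triangle_ineq4)
    also have "\<dots> \<le> norm (f k ?d - 1) + norm t * norm (f k ?d - 1)"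
      by (intro add_mono norm_mult_ineq order_refl)
    also have "\<dots> \<le> 1 / 3 + norm t * (1 / 3)"
      by (intro add_mono mult_left_mono y norm_ge_zero)
    finally have "norm t \<le> 1 / 2" by simp
    then show ?thesis unfolding t_def by (rule power_two_power_tendsto_0)
  qed
  define h where "h = 1 / (6 * Lc)"
  have h: "h > 0" "h * Lc \<le> 1 / 6" using \<open>Lc > 0\<close> by (simp_all add: h_def)
  have big: "(\<lambda>k. S (complex_of_real c) ^ (2 ^ k)) \<longlonglongrightarrow> 0" if "c \<ge> 2 * norm w + 1" for c
  proof -
    have c: "c > 0" using that norm_ge_zero[of w] by linarith
    have "norm (S (complex_of_real c) ^ (2 ^ 0)) = norm w / c"
      using c by (simp add: S_def norm_scaleC norm_inverse divide_inverse mult.commute)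
    also have "\<dots> \<le> 1 / 2" using c that by (simp add: field_simps)
    finally have "norm (S (complex_of_real c) ^ (2 ^ 0)) \<le> 1 / 2" .
    then show ?thesis by (rule power_two_power_tendsto_0)
  qed
  have descend: "(\<lambda>k. S (complex_of_real c) ^ (2 ^ k)) \<longlonglongrightarrow> 0"
    if "c \<ge> r" "c + real n * h \<ge> 2 * norm w + 1" for c n
    using that
  proof (induction n arbitrary: c)
    case 0
    then show ?case using big by simp
  next
    case (Suc n)
    have "(\<lambda>k. S (complex_of_real (c + h)) ^ (2 ^ k)) \<longlonglongrightarrow> 0"
      using Suc.prems h by (intro Suc.IH) (auto simp: algebra_simps)
    then show ?case by (rule step) (use Suc.prems h in auto)
  qed
  obtain n :: nat where "2 * norm w + 1 < real n * h"
    using reals_Archimedean3[OF h(1)] by blast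
  then have "(\<lambda>k. S (complex_of_real r) ^ (2 ^ k)) \<longlonglongrightarrow> 0"
    using descend[of r n] r by simp
  then show ?thesis by (simp add: S_def divide_inverse)
qed

lemma quasi_nilpotent_invertible_diff:
  "quasi_nilpotent w \<Longrightarrow> c \<noteq> 0 \<Longrightarrow> alg_invertible (w - c *\<^sub>C 1)"
  by (auto simp: quasi_nilpotent_def alg_spectrum_def)

text \<open>
  Powers of a quasi-nilpotent element decay faster than every geometric sequence. This gives both that a
  quasi-nilpotent element is not invertible in any nonzero corner and that it is nilpotent
  as soon as its powers can be recovered from higher ones.
\<close>

lemma quasi_nilpotent_geometric_zero:
  fixes w x y d :: "'a::complex_unital_banach_algebra"
  assumes qn: "quasi_nilpotent w" and eq: "\<And>j. x = w ^ j * y * d ^ j"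
  shows "x = 0"
proof -
  define r where "r = 1 / (norm d + 1)"
  have D: "norm d + 1 > 0" by (simp add: add_nonneg_pos)
  then have r: "r > 0" by (simp add: r_def)
  define K where "K = norm y * norm (1 :: 'a)"
  define u where "u = complex_of_real (1 / r) *\<^sub>C w"
  have lim: "(\<lambda>k. u ^ (2 ^ k)) \<longlonglongrightarrow> 0"
    unfolding u_def
    by (intro quasi_nilpotent_scaled_powers_tendsto_0 r) (rule quasi_nilpotent_invertible_diff[OF qn])
  have bound: "norm x \<le> norm (u ^ (2 ^ k)) * K" for k
  proof -
    define N :: nat where "N = 2 ^ k"
    have "norm x = norm (w ^ N * y * d ^ N)" using eq by simp
    also have "\<dots> \<le> norm (w ^ N * y) * norm (d ^ N)" by (rule norm_mult_ineq)
    also have "\<dots> \<le> (norm (w ^ N) * norm y) * (norm (1 :: 'a) * norm d ^ N)"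
      by (intro mult_mono norm_mult_ineq norm_power_le) auto
    also have "\<dots> \<le> (norm (w ^ N) * norm y) * (norm (1 :: 'a) * (norm d + 1) ^ N)"
      by (intro mult_left_mono power_mono) auto
    also have "\<dots> = norm (u ^ N) * K"
      using D unfolding u_def scaleC_power norm_scaleC norm_power
      by (simp add: r_def K_def mult_ac norm_power)
    finally show ?thesis by (simp add: N_def)
  qed
  have "(\<lambda>k. norm (u ^ (2 ^ k)) * K) \<longlonglongrightarrow> 0"
    using tendsto_mult_left_zero[OF tendsto_norm_zero[OF lim]] .
  then have "norm x \<le> 0"
    by (rule tendsto_lowerbound) (use bound in auto)
  then show ?thesis by simp
qed

section \<open>Splitting along an idempotent\<close>

lemma quasi_nilpotent_uminus:
  assumes "quasi_nilpotent w" shows "quasi_nilpotent (- w)"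
proof -
  have neg: "alg_invertible (- x)" if x: "alg_invertible x" for x :: 'a
  proof -
    obtain y where "x * y = 1" "y * x = 1" using x by (auto simp: alg_invertible_def)
    then show ?thesis unfolding alg_invertible_def by (intro exI[of _ "- y"]) simp
  qed
  have "c \<in> alg_spectrum (- w) \<longleftrightarrow> - c \<in> alg_spectrum w" for c
  proof -
    have "- w - c *\<^sub>C 1 = - (w - (- c) *\<^sub>C 1)" by (simp add: scaleC_minus_left)
    then show ?thesis unfolding alg_spectrum_def mem_Collect_eq
      by (metis neg minus_minus)
  qed
  then show ?thesis using assms unfolding quasi_nilpotent_def
    by (metis (no_types, lifting) neg_equal_0_iff_equal singleton_iff set_eqI)
qed

lemma corner_absorb:
  assumes "idempotent_elem e" "x \<in> corner e"
  shows "e * x = x" "x * e = x"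
proof -
  obtain y where x: "x = e * y * e" using assms by (auto simp: corner_def)
  have ee: "e * e = e" using assms by (simp add: idempotent_elem_def)
  show "e * x = x" unfolding x by (metis ee mult.assoc)
  show "x * e = x" unfolding x by (metis ee mult.assoc)
qed

lemma corner_memI: "e * x * e = x \<Longrightarrow> x \<in> corner e"
  unfolding corner_def by (intro CollectI exI[of _ x]) simp

lemma idempotent_complement: "idempotent_elem q \<Longrightarrow> idempotent_elem (1 - q)"
  by (simp add: idempotent_elem_def algebra_simps)

text \<open>
  The element \<open>b\<close> is the block diagonal sum of \<open>n\<close> in the corner of \<open>q\<close> and an element that is
  invertible in the complementary corner.
\<close>

definition splits_along :: "'a::ring_1 \<Rightarrow> 'a \<Rightarrow> 'a \<Rightarrow> bool" where
  "splits_along b q n \<longleftrightarrow>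
     idempotent_elem q \<and> n \<in> corner q \<and> corner_invertible (1 - q) (b - n)"

lemma splits_alongE:
  assumes "splits_along b q n"
  obtains c where "b * c = 1 - q" "c * b = 1 - q" "c * b * c = c" "b * c * b = b - n"
    "b * q = n" "q * b = n" "q * q = q"
proof -
  have q: "idempotent_elem q" and n: "n \<in> corner q"
    and ci: "corner_invertible (1 - q) (b - n)"
    using assms by (auto simp: splits_along_def)
  define u where "u = b - n"
  obtain c where u: "u \<in> corner (1 - q)" and c: "c \<in> corner (1 - q)"
    and uc: "u * c = 1 - q" "c * u = 1 - q"
    using ci by (auto simp: corner_invertible_def u_def)
  have b: "b = n + u" by (simp add: u_def)
  note nq = corner_absorb[OF q n]
  note q' = idempotent_complement[OF q]
  have uq: "q * u = 0" "u * q = 0"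
    using corner_absorb[OF q' u] by (simp_all add: algebra_simps)
  have cq: "q * c = 0" "c * q = 0"
    using corner_absorb[OF q' c] by (simp_all add: algebra_simps)
  have nc: "n * c = 0" "c * n = 0"
    by (metis cq(1) mult.assoc mult_zero_right nq(2), metis cq(2) mult.assoc mult_zero_left nq(1))
  have bc: "b * c = 1 - q" "c * b = 1 - q"
    using uc nc by (simp_all add: b algebra_simps)
  have bq: "b * q = n" "q * b = n" using uq nq by (simp_all add: b algebra_simps)
  show ?thesis
    by (rule that[of c])
      (use bc bq cq q in \<open>simp_all add: left_diff_distrib idempotent_elem_def\<close>)
qed

lemma splits_along_mult:
  assumes "splits_along b q n"
  shows "b * q = n" "q * b = n" "q * q = q"
  using splits_alongE[OF assms] by metis+

text \<open>The spectral idempotent of a generalized inverse \<open>c\<close> that commutes with \<open>b\<close>.\<close>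

lemma splits_alongI:
  fixes b c :: "'a::ring_1"
  assumes "b * c = c * b" "c * b * c = c"
  shows "splits_along b (1 - b * c) (b - b * c * b)"
proof -
  define e where "e = b * c"
  have e: "e * e = e" "e * b = b * e" "e * c = c" "c * e = c"
    unfolding e_def using assms by (metis mult.assoc)+
  have eb: "b - (b - b * c * b) = e * b" "c * b = e" using assms by (simp_all add: e_def)
  have "idempotent_elem (1 - e)" using e by (simp add: idempotent_elem_def algebra_simps)
  moreover have "b - e * b \<in> corner (1 - e)"
  proof (rule corner_memI)
    have "e * b * e = e * b" by (metis e(1,2) mult.assoc)
    moreover have "e * (e * b) = e * b" by (metis e(1) mult.assoc)
    ultimately show "(1 - e) * (b - e * b) * (1 - e) = b - e * b"
      using e by (simp add: left_diff_distrib right_diff_distrib mult.assoc)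
  qed
  moreover have "corner_invertible e (e * b)"
    unfolding corner_invertible_def
  proof (intro conjI bexI[of _ c])
    show "e * b \<in> corner e" by (rule corner_memI) (metis e(1,2) mult.assoc)
    show "c \<in> corner e" by (rule corner_memI) (simp add: e)
    show "e * b * c = e" using e(1) by (simp add: e_def mult.assoc)
    show "c * (e * b) = e" using e(4) eb(2) by (metis mult.assoc)
  qed
  ultimately show ?thesis unfolding splits_along_def eb by (simp add: e_def)
qed

lemma splits_along_power:
  fixes b q n :: "'a::ring_1"
  assumes "splits_along b q n"
  shows "n ^ Suc k = b ^ Suc k * q" "n ^ Suc k = q * b ^ Suc k"
proof -
  note q = splits_along_mult[OF assms]
  have comm: "b ^ i * q = q * b ^ i" for i by (rule commute_power) (simp add: q)
  show *: "n ^ Suc k = b ^ Suc k * q"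
  proof (induction k)
    case (Suc k)
    have "n ^ Suc (Suc k) = (b * q) * (b ^ Suc k * q)"
      using Suc q by simp
    also have "\<dots> = b * (q * b ^ Suc k) * q" by (simp only: mult.assoc)
    also have "\<dots> = b * (b ^ Suc k * q) * q" by (simp only: comm)
    also have "\<dots> = b ^ Suc (Suc k) * (q * q)" by (simp add: mult.assoc)
    finally show ?case by (simp only: q)
  qed (simp add: q)
  show "n ^ Suc k = q * b ^ Suc k" unfolding * by (rule comm)
qed

lemma nilpotent_imp_quasi_nilpotent:
  fixes n :: "'a::complex_unital_banach_algebra"
  assumes "n ^ k = 0"
  shows "quasi_nilpotent n"
proof -
  have "alg_invertible (n - c *\<^sub>C 1)" if "c \<noteq> 0" for c
  proof -
    define s where "s = inverse c *\<^sub>C n"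
    have "s ^ k = 0" unfolding s_def scaleC_power assms
      using mult_scaleC_right[of "0 :: 'a" "inverse c ^ k" 0] by simp
    define g where "g = (\<Sum>i<k. s ^ i)"
    have g: "(1 - s) * g = 1" "g * (1 - s) = 1"
    proof -
      show 1: "(1 - s) * g = 1"
        using sum_lessThan_telescope'[of "\<lambda>i. s ^ i" k] \<open>s ^ k = 0\<close>
        by (simp add: g_def left_diff_distrib sum_distrib_left sum_subtractf)
      have "s * g = g * s"
        unfolding g_def sum_distrib_left sum_distrib_right
        by (rule sum.cong) (simp_all add: power_commutes)
      then show "g * (1 - s) = 1" using 1 by (simp add: algebra_simps)
    qed
    have cs: "n - c *\<^sub>C 1 = (- c) *\<^sub>C (1 - s)"
    proof -
      have "c *\<^sub>C (1 - s) + c *\<^sub>C s = c *\<^sub>C 1" by (simp flip: scaleC_add_right)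
      moreover have "c *\<^sub>C s = n" using that by (simp add: s_def scaleC_scaleC scaleC_one)
      ultimately show ?thesis by (simp add: scaleC_minus_left algebra_simps)
    qed
    show ?thesis unfolding alg_invertible_def cs
      by (intro exI[of _ "(- inverse c) *\<^sub>C g"])
        (use that g in \<open>simp add: mult_scaleC_left mult_scaleC_right scaleC_scaleC scaleC_one\<close>)
  qed
  moreover have "\<not> alg_invertible n"
  proof
    assume "alg_invertible n"
    then obtain y where y: "n * y = 1" "y * n = 1" by (auto simp: alg_invertible_def)
    have "n ^ i * y ^ i = 1" for i
    proof (induction i)
      case (Suc i)
      have "n ^ Suc i * y ^ Suc i = n ^ i * (n * y) * y ^ i"
        by (simp only: power_Suc2[of n i] power_Suc[of y i] mult.assoc)
      then show ?case using Suc y by simp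
    qed simp
    from this[of k] show False using assms by simp
  qed
  ultimately show ?thesis
    unfolding quasi_nilpotent_def alg_spectrum_def by (auto simp: scaleC_zero_left)
qed

section \<open>Koliha-Drazin and Drazin invertibility through splittings\<close>

text \<open>
  Here \<open>n\<close> is quasi-nilpotent in the whole algebra. If \<open>q \<noteq> 1\<close>, the point \<open>0\<close> of its spectrum
  comes from the complement of \<open>q\<close>, and the claim depends on the fact that spectra in the corner
  of \<open>q\<close> are nonempty.
\<close>

lemma splits_along_not_invertible:
  assumes sp: "splits_along b q n" and qn: "quasi_nilpotent n" and q0: "q \<noteq> 0"
  shows "\<not> alg_invertible b"
proof
  assume "alg_invertible b"
  then obtain d where d: "b * d = 1" by (auto simp: alg_invertible_def)
  note q = splits_along_mult[OF sp]
  \<comment> \<open>In the corner of \<open>q\<close>, \<open>n\<close> would be invertible, with inverse \<open>q * d\<close>.\<close>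
  have "q = n ^ j * q * d ^ j" for j
  proof (induction j)
    case (Suc j)
    have "n ^ Suc j * q * d ^ Suc j = n ^ j * (n * q) * d * d ^ j"
      by (simp only: power_Suc2[of n] power_Suc[of d] mult.assoc)
    also have "n * q = q * b" using q by (metis mult.assoc)
    also have "n ^ j * (q * b) * d * d ^ j = n ^ j * q * (b * d) * d ^ j"
      by (simp only: mult.assoc)
    finally show ?case using Suc d by simp
  qed simp
  from quasi_nilpotent_geometric_zero[OF qn this] q0 show False by simp
qed

lemma splits_along_imp_Koliha_Drazin:
  assumes sp: "splits_along b q n" and qn: "quasi_nilpotent n"
  shows "Koliha_Drazin_invertible b"
proof -
  obtain c where "b * c = 1 - q" "c * b = 1 - q" "c * b * c = c" "b * c * b = b - n"
    using splits_alongE[OF sp] by metis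
  then show ?thesis unfolding Koliha_Drazin_invertible_def
    by (intro exI[of _ c] exI[of _ "- n"]) (use quasi_nilpotent_uminus[OF qn] in simp)
qed

lemma Koliha_Drazin_imp_splits_along:
  assumes "Koliha_Drazin_invertible b"
  obtains q n where "splits_along b q n" "quasi_nilpotent n"
proof -
  obtain c w where c: "b * c = c * b" "c * b * c = c" "b * c * b = b + w" "quasi_nilpotent w"
    using assms by (auto simp: Koliha_Drazin_invertible_def)
  show ?thesis
    using that[OF splits_alongI[OF c(1,2)]] c quasi_nilpotent_uminus[OF c(4)] by simp
qed

lemma splits_along_imp_Drazin:
  assumes sp: "splits_along b q n" and nil: "n ^ k = 0" and k: "k \<ge> 1"
  shows "Drazin_invertible b"
proof -
  obtain c where c: "b * c = 1 - q" "c * b = 1 - q" "c * b * c = c"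
    using splits_alongE[OF sp] by metis
  have "b ^ k * q = 0" using splits_along_power(1)[OF sp, of "k - 1"] k nil by simp
  then have "b ^ k * c * b = b ^ k" by (simp add: mult.assoc c right_diff_distrib)
  then show ?thesis unfolding Drazin_invertible_def using c by metis
qed

lemma Drazin_imp_splits_along:
  fixes b :: "'a::ring_1"
  assumes "Drazin_invertible b"
  obtains q n k where "splits_along b q n" "k \<ge> 1" "n ^ k = 0"
proof -
  obtain c m where c: "b * c = c * b" "c * b * c = c" "b ^ m * c * b = b ^ m"
    using assms by (auto simp: Drazin_invertible_def)
  note sp = splits_alongI[OF c(1,2)]
  have "b ^ m * (b * c) = b ^ m" using c by (metis mult.assoc)
  then have "b ^ Suc m * (1 - b * c) = 0"
    by (simp add: right_diff_distrib mult.assoc)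
  then have "(b - b * c * b) ^ Suc m = 0" using splits_along_power(1)[OF sp] by simp
  with that[OF sp] show ?thesis by (metis le_add1 plus_1_eq_Suc)
qed

text \<open>
  Whichever splitting with a quasi-nilpotent block is used, Drazin invertibility of \<open>b\<close> forces
  that block to be nilpotent. No relation between \<open>q\<close> and the idempotent of the Drazin inverse is
  needed: the identity \<open>b ^ m = b ^ (m + 1) * c\<close> is multiplied by \<open>q\<close>.
\<close>

lemma Drazin_imp_nilpotent_part:
  assumes sp: "splits_along b q n" and qn: "quasi_nilpotent n" and D: "Drazin_invertible b"
  obtains k where "k \<ge> 1" "n ^ k = 0"
proof -
  obtain c m where c: "b * c = c * b" "b ^ m * c * b = b ^ m"
    using D by (auto simp: Drazin_invertible_def)
  have bm: "b ^ Suc m = b * b ^ Suc m * c"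
    using c by (metis mult.assoc power_Suc power_commutes)
  have nb: "n * n ^ Suc m * c = n ^ Suc m"
  proof -
    have "n * n ^ Suc m * c = q * (b * b ^ Suc m * c)"
      using splits_along_power(2)[OF sp, of "Suc m"] by (simp add: mult.assoc)
    then show ?thesis using bm splits_along_power(2)[OF sp, of m] by metis
  qed
  have "n ^ Suc m = n ^ j * n ^ Suc m * c ^ j" for j
  proof (induction j)
    case (Suc j)
    have "n ^ Suc j * n ^ Suc m * c ^ Suc j = n ^ j * (n * n ^ Suc m * c) * c ^ j"
      by (simp only: power_Suc2[of n j] power_Suc[of c j] mult.assoc)
    then show ?case using Suc nb by simp
  qed simp
  from quasi_nilpotent_geometric_zero[OF qn this] that[of "Suc m"] show ?thesis by simp
qed

lemma splits_along_zero_imp_invertible: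
  assumes "splits_along b 0 n" shows "alg_invertible b"
proof -
  obtain c where "b * c = 1 - 0" "c * b = 1 - 0" using splits_alongE[OF assms] by metis
  then show ?thesis by (auto simp: alg_invertible_def)
qed

lemma Drazin_if_invertible:
  assumes "alg_invertible b" shows "Drazin_invertible b"
proof -
  obtain c where "b * c = 1" "c * b = 1" using assms by (auto simp: alg_invertible_def)
  then show ?thesis unfolding Drazin_invertible_def
    by (intro exI[of _ c] exI[of _ 0]) simp
qed

section \<open>Lifting splittings\<close>

text \<open>
  The decompositions of \<open>a\<close> modulo the kernel correspond to the splittings of \<open>T a\<close>. The predicate
  \<open>P\<close> stands for the condition imposed on the first block.
\<close>

lemma splitting_lifts_iff:
  fixes T :: "'a::complex_unital_banach_algebra \<Rightarrow> 'b::complex_unital_banach_algebra"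
  assumes hom: "algebra_hom T" and surj: "surj T" and lift: "lifting_property T"
  shows "(\<exists>q n. splits_along (T a) q n \<and> q \<noteq> 0 \<and> P n) \<longleftrightarrow>
    (\<exists>p x y z. idempotent_elem p \<and> p \<notin> hom_kernel T \<and> P (T (p * x * p)) \<and>
       y \<in> corner (1 - p) \<and> y \<in> corner_Fredholm_elems T (1 - p) (1 - T p) \<and>
       z \<in> hom_kernel T \<and> a = p * x * p + y + z)"
    (is "?L \<longleftrightarrow> ?R")
proof -
  interpret T: Vector_Spaces.linear scaleC scaleC T
    using hom by (simp add: algebra_hom_def)
  have mult: "T (x * y) = T x * T y" for x y using hom by (simp add: algebra_hom_def)
  have one: "T 1 = 1"
    using surj by (metis mult mult_1_left mult_1_right surjD)
  show ?thesis
  proof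
    assume ?L
    then obtain q n where sp: "splits_along (T a) q n" and q0: "q \<noteq> 0" and P: "P n" by blast
    then obtain p where p: "idempotent_elem p" "T p = q"
      using lift by (auto simp: lifting_property_def splits_along_def)
    note q = splits_along_mult[OF sp]
    have nq: "n * q = n" "q * n = n" using q by (metis mult.assoc)+
    define y where "y = (1 - p) * a * (1 - p)"
    have yc: "y \<in> corner (1 - p)" by (auto simp: y_def corner_def)
    have Tx: "T (p * a * p) = n" by (simp add: mult p q nq)
    have Ty: "T y = T a - n"
      using q nq by (simp add: y_def mult T.diff one p left_diff_distrib right_diff_distrib)
    show ?R
    proof (intro exI conjI)
      show "a = p * a * p + y + (a - p * a * p - y)" by simp
      show "a - p * a * p - y \<in> hom_kernel T" by (simp add: hom_kernel_def T.diff Tx Ty)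
      show "y \<in> corner_Fredholm_elems T (1 - p) (1 - T p)"
        using sp yc Ty p by (simp add: corner_Fredholm_elems_def splits_along_def)
    qed (use p q0 P Tx yc in \<open>auto simp: hom_kernel_def\<close>)
  next
    assume ?R
    then obtain p x y z where *: "idempotent_elem p" "p \<notin> hom_kernel T" "P (T (p * x * p))"
      "y \<in> corner_Fredholm_elems T (1 - p) (1 - T p)"
      "z \<in> hom_kernel T" "a = p * x * p + y + z" by blast
    have "T a - T (p * x * p) = T y" using *(5,6) by (simp add: T.add hom_kernel_def)
    moreover have "T (p * x * p) \<in> corner (T p)" by (auto simp: corner_def mult)
    moreover have "idempotent_elem (T p)" using *(1) by (metis idempotent_elem_def mult)
    ultimately have "splits_along (T a) (T p) (T (p * x * p))"
      using *(4) by (simp add: splits_along_def corner_Fredholm_elems_def)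
    then show ?L using * by (auto simp: hom_kernel_def)
  qed
qed

lemma mem_hom_nilpotent_elems_iff:
  fixes T :: "'a::complex_unital_banach_algebra \<Rightarrow> 'b::complex_unital_banach_algebra"
  assumes "algebra_hom T" "surj T"
  shows "x \<in> hom_nilpotent_elems T \<longleftrightarrow> (\<exists>k\<ge>1. T x ^ k = 0)"
proof -
  have mult: "T (x * y) = T x * T y" for x y using assms by (simp add: algebra_hom_def)
  have "T 1 = 1" using assms(2) by (metis mult mult_1_left mult_1_right surjD)
  then have "T (x ^ k) = T x ^ k" for k by (induction k) (simp_all add: mult)
  then show ?thesis by (simp add: hom_nilpotent_elems_def hom_kernel_def)
qed

theorem theorem3p5:
  fixes T :: "'a::complex_unital_banach_algebra \<Rightarrow> 'b::complex_unital_banach_algebra"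
    and a :: 'a and b :: 'b
  assumes "algebra_hom T" and "surj T" and "lifting_property T" and "T a = b"
  shows
    "(Koliha_Drazin_invertible b \<and> \<not> alg_invertible b \<longleftrightarrow>
       (\<exists>p x y z. idempotent_elem p \<and> p \<notin> hom_kernel T \<and>
          p * x * p \<in> Riesz_elems T \<and>
          y \<in> corner (1 - p) \<and> y \<in> corner_Fredholm_elems T (1 - p) (1 - T p) \<and>
          z \<in> hom_kernel T \<and> a = p * x * p + y + z)) \<and>
     (Drazin_invertible b \<and> \<not> alg_invertible b \<longleftrightarrow>
       (\<exists>p x y z. idempotent_elem p \<and> p \<notin> hom_kernel T \<and>
          p * x * p \<in> hom_nilpotent_elems T \<and>
          y \<in> corner (1 - p) \<and> y \<in> corner_Fredholm_elems T (1 - p) (1 - T p) \<and>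
          z \<in> hom_kernel T \<and> a = p * x * p + y + z)) \<and>
     (Koliha_Drazin_invertible b \<and> \<not> Drazin_invertible b \<longleftrightarrow>
       (\<exists>p x y z. idempotent_elem p \<and> p \<notin> hom_kernel T \<and>
          p * x * p \<in> Riesz_elems T - hom_nilpotent_elems T \<and>
          y \<in> corner (1 - p) \<and> y \<in> corner_Fredholm_elems T (1 - p) (1 - T p) \<and>
          z \<in> hom_kernel T \<and> a = p * x * p + y + z))"
proof -
  let ?nil = "\<lambda>n :: 'b. \<exists>k\<ge>1. n ^ k = 0"
  have riesz: "x \<in> Riesz_elems T \<longleftrightarrow> quasi_nilpotent (T x)" for x
    by (simp add: Riesz_elems_def)
  note mem = riesz mem_hom_nilpotent_elems_iff[OF assms(1,2)] Diff_iff
  note lifts = splitting_lifts_iff[OF assms(1-3), of a, unfolded assms(4)]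
  have KD: "Koliha_Drazin_invertible b \<and> \<not> alg_invertible b \<longleftrightarrow>
      (\<exists>q n. splits_along b q n \<and> q \<noteq> 0 \<and> quasi_nilpotent n)"
  proof
    assume *: "Koliha_Drazin_invertible b \<and> \<not> alg_invertible b"
    then obtain q n where "splits_along b q n" "quasi_nilpotent n"
      using Koliha_Drazin_imp_splits_along by blast
    with * show "\<exists>q n. splits_along b q n \<and> q \<noteq> 0 \<and> quasi_nilpotent n"
      using splits_along_zero_imp_invertible by blast
  qed (use splits_along_imp_Koliha_Drazin splits_along_not_invertible in blast)
  have D: "Drazin_invertible b \<and> \<not> alg_invertible b \<longleftrightarrow>
      (\<exists>q n. splits_along b q n \<and> q \<noteq> 0 \<and> ?nil n)"
  proof
    assume *: "Drazin_invertible b \<and> \<not> alg_invertible b"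
    then obtain q n k where "splits_along b q n" "k \<ge> 1" "n ^ k = 0"
      using Drazin_imp_splits_along by blast
    with * show "\<exists>q n. splits_along b q n \<and> q \<noteq> 0 \<and> ?nil n"
      using splits_along_zero_imp_invertible by blast
  qed (use splits_along_imp_Drazin splits_along_not_invertible nilpotent_imp_quasi_nilpotent
      in blast)
  have KDD: "Koliha_Drazin_invertible b \<and> \<not> Drazin_invertible b \<longleftrightarrow>
      (\<exists>q n. splits_along b q n \<and> q \<noteq> 0 \<and> quasi_nilpotent n \<and> \<not> ?nil n)"
  proof
    assume *: "Koliha_Drazin_invertible b \<and> \<not> Drazin_invertible b"
    then obtain q n where sp: "splits_along b q n" "quasi_nilpotent n"
      using Koliha_Drazin_imp_splits_along by blast
    have "q \<noteq> 0"
      using * sp(1) splits_along_zero_imp_invertible Drazin_if_invertible by blast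
    moreover have "\<not> ?nil n" using * sp(1) splits_along_imp_Drazin by blast
    ultimately show "\<exists>q n. splits_along b q n \<and> q \<noteq> 0 \<and> quasi_nilpotent n \<and> \<not> ?nil n"
      using sp by blast
  next
    assume "\<exists>q n. splits_along b q n \<and> q \<noteq> 0 \<and> quasi_nilpotent n \<and> \<not> ?nil n"
    then obtain q n where sp: "splits_along b q n" "quasi_nilpotent n" and "\<not> ?nil n"
      by blast
    then show "Koliha_Drazin_invertible b \<and> \<not> Drazin_invertible b"
      using splits_along_imp_Koliha_Drazin[OF sp] Drazin_imp_nilpotent_part[OF sp] by blast
  qed
  show ?thesis
    unfolding mem KD D KDD
    by (intro conjI lifts[of quasi_nilpotent] lifts[of ?nil]
        lifts[of "\<lambda>n. quasi_nilpotent n \<and> \<not> ?nil n"])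
qed

end
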